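(* Let $\mathbb{L}$ be a Dedekind complete unital $f$-algebra, let $(S,\Sigma)$ be a measurable space, and let $f\in\mathcal{M}(S,\Sigma;\overline{\mathbb{L}^+})$. Then there exists an increasing sequence $(\varphi_n)$ of bounded measurable step functions such that $\varphi_n\uparrow f$ pointwise.
   Context: $\mathbb{L}$ is a Dedekind complete unital $f$-algebra with multiplicative unit $1$; $\mathbb{L}_1$ is the order ideal of $\mathbb{L}$ generated by $1$. $\overline{\mathbb{L}^+}=\mathbb{L}^+\cup\{\infty\}$, where $\lambda\le\infty$ for all $\lambda$; every nonempty subset of $\overline{\mathbb{L}^+}$ has a supremum there. A measurable step function is a function $\phi:S\to\mathbb{L}$ with finite range $\{\lambda_1,\dots,\lambda_n\}$ such that each $\phi^{-1}(\lambda_i)$ is in $\Sigma$; it is positive if its values lie in $\mathbb{L}^+$, and it is a bounded measurable step function if all its values lie in $\mathbb{L}_1$. For functions $f_n,f:S\to\overline{\mathbb{L}^+}$, "$f_n\uparrow f$ pointwise" means that for every $s\in S$ the sequence $(f_n(s))$ is increasing and $\sup_n f_n(s)=f(s)$ in $\overline{\mathbb{L}^+}$. $\mathcal{M}(S,\Sigma;\overline{\mathbb{L}^+})$ is the set of all functions $f:S\to\overline{\mathbb{L}^+}$ for which there exists a sequence $(\phi_n)$ of positive measurable step functions ($\mathbb{L}^+$-valued, not necessarily $\mathbb{L}_1$-valued) with $\phi_n\uparrow f$ pointwise. *)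

theory Defs
  imports "HOL-Analysis.Analysis" "HOL-Library.Extended" "HOL-Library.Lattice_Algebras"
    "HOL-Library.Lub_Glb"
begin

text \<open>
  A unital $f$-algebra: a real vector lattice with an associative, positive and unital bilinear
  multiplication such that multiplying by a positive element preserves disjointness from a given
  element. The absolute value is the lattice-theoretic one, \<open>sup a (- a)\<close>. Instead of
  \<^class>\<open>real_algebra_1\<close> we use \<^class>\<open>monoid_mult\<close>, as the former would exclude the zero algebra.
\<close>

class unital_f_algebra = lattice_ring + ordered_real_vector + real_algebra + monoid_mult +
  assumes inf_mult_left_eq_0: "inf a b = 0 \<Longrightarrow> 0 \<le> c \<Longrightarrow> inf (c * a) b = 0"
    and inf_mult_right_eq_0: "inf a b = 0 \<Longrightarrow> 0 \<le> c \<Longrightarrow> inf (a * c) b = 0"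

class dedekind_complete_unital_f_algebra = unital_f_algebra + conditionally_complete_lattice

definition order_ideal :: "'a::{lattice_ab_group_add_abs, real_vector} set \<Rightarrow> bool" where
  "order_ideal I \<longleftrightarrow> subspace I \<and> (\<forall>x y. y \<in> I \<longrightarrow> \<bar>x\<bar> \<le> \<bar>y\<bar> \<longrightarrow> x \<in> I)"

definition unit_ideal :: "'a::unital_f_algebra set" where
  "unit_ideal = order_ideal hull {1}"

text \<open>
  The extended positive cone, as a subset of the library type that adjoins both a largest element
  \<^const>\<open>Pinf\<close> and a smallest one (the latter is not used).
\<close>

definition ext_pos_cone :: "'a::{order, zero} extended set" where
  "ext_pos_cone = insert Pinf (Fin ` {0..})"

text \<open>
  Functions on the underlying set \<open>S\<close> of a measurable space are total functions whose values outside
  \<open>S\<close> are irrelevant. The least upper bound is taken within the extended positive cone.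
\<close>

definition increases_pointwise_to ::
    "'s set \<Rightarrow> (nat \<Rightarrow> 's \<Rightarrow> 'a::{order, zero} extended) \<Rightarrow> ('s \<Rightarrow> 'a extended) \<Rightarrow> bool" where
  "increases_pointwise_to S F f \<longleftrightarrow>
     (\<forall>n. F n \<in> S \<rightarrow> ext_pos_cone) \<and> f \<in> S \<rightarrow> ext_pos_cone \<and>
     (\<forall>s\<in>S. incseq (\<lambda>n. F n s) \<and> isLub ext_pos_cone (range (\<lambda>n. F n s)) (f s))"

text \<open>
  Measurable step functions are the library's \<^const>\<open>simple_function\<close>s. Only the underlying
  measurable space of the argument \<open>M\<close> matters, not its measure.
\<close>

definition positive_step_function :: "'s measure \<Rightarrow> ('s \<Rightarrow> 'a::{order, zero}) \<Rightarrow> bool" where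
  "positive_step_function M \<phi> \<longleftrightarrow> simple_function M \<phi> \<and> (\<forall>s\<in>space M. 0 \<le> \<phi> s)"

definition bounded_step_function :: "'s measure \<Rightarrow> ('s \<Rightarrow> 'a::unital_f_algebra) \<Rightarrow> bool" where
  "bounded_step_function M \<phi> \<longleftrightarrow> simple_function M \<phi> \<and> (\<forall>s\<in>space M. \<phi> s \<in> unit_ideal)"

definition ext_pos_measurable :: "'s measure \<Rightarrow> ('s \<Rightarrow> 'a::{order, zero} extended) set" where
  "ext_pos_measurable M =
     {f. \<exists>\<phi>. (\<forall>n. positive_step_function M (\<phi> n)) \<and>
             increases_pointwise_to (space M) (\<lambda>n s. Fin (\<phi> n s)) f}"

end

theory Submission
  imports Defs
begin

text \<open>
  Truncate the given step functions \<open>\<psi> n\<close> at \<open>n \<cdot> 1\<close>. The supremum is unchanged because the unit of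
  an $f$-algebra is a weak order unit: if \<open>1 \<and> c = 0\<close>, then \<open>c = c * 1\<close> is also disjoint from \<open>c\<close>, so
  \<open>c = 0\<close>. For \<open>a \<ge> 0\<close>, the supremum \<open>w\<close> of the elements \<open>a \<and> n \<cdot> 1\<close> exists by Dedekind completeness,
  and adding \<open>1 \<and> (a - w)\<close> to such an element stays below the next one; hence \<open>1 \<and> (a - w) = 0\<close> and
  \<open>w = a\<close>.
\<close>

lemma unital_f_algebra_inf_one_eq_0D:
  fixes c :: "'a::unital_f_algebra"
  assumes "inf 1 c = 0"
  shows "c = 0"
proof -
  have "0 \<le> c"
    using assms by (metis inf_le2)
  with assms have "inf (c * 1) c = 0"
    by (rule inf_mult_left_eq_0)
  then show ?thesis
    by simp
qed

text \<open>Split \<open>1 = p - m\<close> into disjoint positive and negative parts. Multiplying by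
  \<open>m\<close> preserves disjointness, which forces first \<open>m * m = 0\<close> and then
  \<open>m = 0\<close>.\<close>

lemma unital_f_algebra_zero_le_one: "0 \<le> (1::'a::unital_f_algebra)"
proof -
  define p m :: 'a where "p = pprt 1" and "m = - nprt 1"
  have one: "1 = p - m"
    using prts[of "1::'a"] by (simp add: p_def m_def)
  have m0: "0 \<le> m"
    by (simp add: m_def)
  \<comment> \<open>Translating by \<open>m\<close> reduces the infimum to
    \<open>m + inf 1 0\<close>, and \<open>inf 1 0\<close> is \<open>- m\<close>.\<close>
  have "inf p m = inf (m + (p - m)) (m + 0)"
    by simp
  also have "\<dots> = m + inf (p - m) 0"
    by (simp only: add_inf_distrib_left)
  also have "\<dots> = 0"
    unfolding one[symmetric] unfolding m_def nprt_def by (rule left_minus)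
  finally have disj: "inf p m = 0" .
  have mp: "inf (m * p) m = 0"
    using inf_mult_left_eq_0[OF disj m0] .
  then have "inf (m * m) (m * p) = 0"
    by (intro inf_mult_left_eq_0 m0) (simp only: inf.commute)
  \<comment> \<open>Since \<open>m * (p - m) = m * 1 = m\<close> is positive, \<open>m * m\<close>
    is the smaller of two disjoint elements and hence zero.\<close>
  moreover have m_eq: "m * p - m * m = m"
    by (simp flip: one right_diff_distrib)
  then have "m * m \<le> m * p"
    using m0 diff_ge_0_iff_ge[of "m * p" "m * m"] by (simp only:)
  ultimately have "m * m = 0"
    by (simp only: inf.absorb1)
  then have "m * p = m"
    using m_eq by (simp only: diff_0_right)
  then have "m = 0"
    using mp by (simp only: inf.idem)
  then have "p = 1"
    using one by (simp only: diff_0_right)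
  then show ?thesis
    using zero_le_pprt[of "1::'a"] by (simp only: p_def)
qed

text \<open>Stated for an arbitrary bound \<open>v\<close> because the theorem has to compare the
  upper bounds of the truncated and the original sequence.\<close>

lemma le_if_inf_multiples_one_le:
  fixes a v :: "'a::dedekind_complete_unital_f_algebra"
  assumes le: "\<And>n::nat. inf a (real n *\<^sub>R 1) \<le> v"
  shows "a \<le> v"
proof -
  define w where "w = (SUP n::nat. inf a (real n *\<^sub>R 1))"
  have bdd: "bdd_above (range (\<lambda>n::nat. inf a (real n *\<^sub>R 1)))"
    using le by (intro bdd_aboveI[of _ v]) auto
  have upper: "inf a (real n *\<^sub>R 1) \<le> w" for n :: nat
    unfolding w_def by (rule cSUP_upper[OF _ bdd]) simp
  have w_le: "w \<le> x" if "\<And>n::nat. inf a (real n *\<^sub>R 1) \<le> x" for x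
    unfolding w_def using that by (intro cSUP_least) auto
  have "w \<le> a"
    by (rule w_le) simp
  define e where "e = inf 1 (a - w)"
  have "inf a (real n *\<^sub>R 1) + e \<le> w" for n :: nat
  proof -
    \<comment> \<open>The two bounds on \<open>e\<close> serve separately:
      \<open>e \<le> a - w\<close> keeps the sum below \<open>a\<close>, and
      \<open>e \<le> 1\<close> keeps it below the next multiple of \<open>1\<close>.\<close>
    have "inf a (real n *\<^sub>R 1) + e \<le> w + (a - w)"
      by (rule add_mono[OF upper]) (simp add: e_def)
    moreover have "inf a (real n *\<^sub>R 1) + e \<le> real n *\<^sub>R 1 + 1"
      by (rule add_mono) (simp_all add: e_def)
    ultimately have "inf a (real n *\<^sub>R 1) + e \<le> inf a (real (Suc n) *\<^sub>R 1)"
      by (simp add: algebra_simps)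
    then show ?thesis
      using upper order_trans by blast
  qed
  \<comment> \<open>Now \<open>w - e\<close> also bounds all truncations, so leastness of
    \<open>w\<close> applies.\<close>
  then have "w \<le> w - e"
    by (intro w_le) (simp add: le_diff_eq)
  then have "e \<le> 0"
    by simp
  moreover have "0 \<le> e"
    using \<open>w \<le> a\<close> by (simp add: e_def unital_f_algebra_zero_le_one)
  ultimately have "e = 0"
    by (rule antisym)
  then have "a - w = 0"
    unfolding e_def by (rule unital_f_algebra_inf_one_eq_0D)
  moreover have "w \<le> v"
    using le by (rule w_le)
  ultimately show ?thesis
    by simp
qed

text \<open>Each order ideal containing \<open>1\<close> contains its multiples and, being solid,
  everything between 0 and such a multiple.\<close>

lemma mem_unit_ideal_if_le_multiple_one:
  fixes x :: "'a::unital_f_algebra"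
  assumes "0 \<le> x" "x \<le> real n *\<^sub>R 1"
  shows "x \<in> unit_ideal"
  unfolding unit_ideal_def hull_def
proof (rule InterI)
  fix I :: "'a set"
  assume "I \<in> {t. order_ideal t \<and> {1} \<subseteq> t}"
  then have I: "order_ideal I" "1 \<in> I"
    by auto
  then have "real n *\<^sub>R 1 \<in> I"
    by (simp add: order_ideal_def subspace_scale)
  moreover have "\<bar>x\<bar> \<le> \<bar>real n *\<^sub>R 1\<bar>"
    using assms order_trans[OF assms] by simp
  ultimately show "x \<in> I"
    using I by (auto simp: order_ideal_def)
qed

theorem theorem3p8:
  fixes M :: "'s measure"
    and f :: "'s \<Rightarrow> 'a::dedekind_complete_unital_f_algebra extended"
  assumes "f \<in> ext_pos_measurable M"
  shows "\<exists>\<phi> :: nat \<Rightarrow> 's \<Rightarrow> 'a.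
    (\<forall>n. bounded_step_function M (\<phi> n)) \<and>
    (\<forall>s\<in>space M. incseq (\<lambda>n. \<phi> n s)) \<and>
    increases_pointwise_to (space M) (\<lambda>n s. Fin (\<phi> n s)) f"
proof -
  obtain \<psi> :: "nat \<Rightarrow> 's \<Rightarrow> 'a" where simple: "\<And>n. simple_function M (\<psi> n)"
    and nonneg: "\<And>n s. s \<in> space M \<Longrightarrow> 0 \<le> \<psi> n s"
    and f: "f \<in> space M \<rightarrow> ext_pos_cone"
    and mono: "\<And>s. s \<in> space M \<Longrightarrow> incseq (\<lambda>n. Fin (\<psi> n s))"
    and lub: "\<And>s. s \<in> space M \<Longrightarrow> isLub ext_pos_cone (range (\<lambda>n. Fin (\<psi> n s))) (f s)"
    using assms
    unfolding ext_pos_measurable_def positive_step_function_def increases_pointwise_to_def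
    by blast
  define \<phi> :: "nat \<Rightarrow> 's \<Rightarrow> 'a" where "\<phi> = (\<lambda>n s. inf (\<psi> n s) (real n *\<^sub>R 1))"
  have \<psi>_mono: "\<psi> m s \<le> \<psi> n s" if "s \<in> space M" "m \<le> n" for m n s
    using incseqD[OF mono] that by fastforce
  have one_mono: "real m *\<^sub>R 1 \<le> real n *\<^sub>R (1::'a)" if "m \<le> n" for m n
    using that by (intro scaleR_right_mono unital_f_algebra_zero_le_one) simp
  have \<phi>_nonneg: "0 \<le> \<phi> n s" if "s \<in> space M" for n s
    using that nonneg one_mono[of 0 n] by (simp add: \<phi>_def)
  have bounded: "bounded_step_function M (\<phi> n)" for n
    unfolding bounded_step_function_def
  proof (intro conjI ballI)
    show "simple_function M (\<phi> n)"
      unfolding \<phi>_def by (rule simple_function_compose1[OF simple])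
    show "\<phi> n s \<in> unit_ideal" if "s \<in> space M" for s
      using \<phi>_nonneg[OF that]
      by (rule mem_unit_ideal_if_le_multiple_one[where n = n]) (simp add: \<phi>_def)
  qed
  have inc: "incseq (\<lambda>n. \<phi> n s)" if "s \<in> space M" for s
    unfolding \<phi>_def by (intro incseq_def[THEN iffD2] allI impI inf_mono \<psi>_mono one_mono that)
  have "isLub ext_pos_cone (range (\<lambda>n. Fin (\<phi> n s))) (f s)" if s: "s \<in> space M" for s
  proof (intro isLubI2 isUbI)
    show "f s \<in> ext_pos_cone"
      using f s by blast
    have "Fin (\<phi> n s) \<le> f s" for n
    proof -
      have "Fin (\<phi> n s) \<le> Fin (\<psi> n s)"
        by (simp add: \<phi>_def)
      also have "\<dots> \<le> f s"
        using isLubD2[OF lub[OF s]] by simp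
      finally show ?thesis .
    qed
    then show "range (\<lambda>n. Fin (\<phi> n s)) *<= f s"
      by (auto simp: setle_def)
    show "f s <=* Collect (isUb ext_pos_cone (range (\<lambda>n. Fin (\<phi> n s))))"
    proof (intro setgeI ballI)
      fix u
      assume "u \<in> Collect (isUb ext_pos_cone (range (\<lambda>n. Fin (\<phi> n s))))"
      then have u: "u \<in> ext_pos_cone" and ub: "\<And>n. Fin (\<phi> n s) \<le> u"
        by (auto simp: isUb_def setle_def)
      \<comment> \<open>As \<open>f s\<close> is the least upper bound of the untruncated values, it
        suffices that \<open>u\<close> bounds these.\<close>
      have "Fin (\<psi> m s) \<le> u" for m
      proof (cases u)
        case (Fin v)
        have "inf (\<psi> m s) (real n *\<^sub>R 1) \<le> v" for n :: nat
        proof -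
          \<comment> \<open>In \<open>\<phi>\<close> one index governs both the function and the
            truncation level; passing to the maximum lets \<open>m\<close> stay fixed while
            \<open>n\<close> varies.\<close>
          have "inf (\<psi> m s) (real n *\<^sub>R 1) \<le> \<phi> (max m n) s"
            unfolding \<phi>_def by (intro inf_mono \<psi>_mono one_mono s) simp_all
          also have "\<dots> \<le> v"
            using ub[of "max m n"] Fin by simp
          finally show ?thesis .
        qed
        then show ?thesis
          unfolding Fin by (simp add: le_if_inf_multiples_one_le)
      qed (use u in \<open>auto simp: ext_pos_cone_def\<close>)
      then have "isUb ext_pos_cone (range (\<lambda>n. Fin (\<psi> n s))) u"
        using u by (auto simp: isUb_def setle_def)
      then show "f s \<le> u"
        using lub[OF s] by (rule isLub_le_isUb[rotated])
    qed
  qed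
  then have "increases_pointwise_to (space M) (\<lambda>n s. Fin (\<phi> n s)) f"
    unfolding increases_pointwise_to_def
    using f \<phi>_nonneg inc by (auto simp: ext_pos_cone_def incseq_def)
  then show ?thesis
    using bounded inc by blast
qed

end
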